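(* Let $\mathcal D_{\mathrm{tr}}$ be a (random) training data set of $N_{\mathrm{tr}}\ge 2$ residual injections in $\mathbb R^n$, and let the residual mean estimate $\widehat{\bm\mu}_r\in\mathbb R^n$ and the positive one-sided scales $a_\ell^+,a_\ell^->0$, $\ell\in\mathcal E$ (defined in the context), be computed using only $\mathcal D_{\mathrm{tr}}$. Let $\bm r^{(1)},\dots,\bm r^{(N_{\mathrm{cal}})}$ be the calibration residuals, let $\bm r^{\mathrm{new}}$ be a future residual, and suppose that they are exchangeable conditional on $\mathcal D_{\mathrm{tr}}$. Write $y_\ell^{(i)}=[K(\bm r^{(i)}-\widehat{\bm\mu}_r)]_\ell$ and $[x]_+=\max\{x,0\}$, and define the one-sided joint nonconformity scores, for $i=1,\dots,N_{\mathrm{cal}}$, $$R_i^{\mathrm{joint}+}=\max_{\ell\in\mathcal E}\frac{[y_\ell^{(i)}]_+}{a_\ell^+},\qquad R_i^{\mathrm{joint}-}=\max_{\ell\in\mathcal E}\frac{[-y_\ell^{(i)}]_+}{a_\ell^-}.$$ Let $\epsilon^+,\epsilon^-\in(0,1)$ with $\epsilon=\epsilon^++\epsilon^-$, and let $q_{1-\epsilon^\pm}^{\mathrm{joint}\pm}$ be the split-conformal quantiles of these scores, namely the $k^\pm$-th smallest element of $R_1^{\mathrm{joint}\pm},\dots,R_{N_{\mathrm{cal}}}^{\mathrm{joint}\pm}$ with $k^\pm=\lceil(N_{\mathrm{cal}}+1)(1-\epsilon^\pm)\rceil$, interpreted as $+\infty$ if $k^\pm=N_{\mathrm{cal}}+1$.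 Set $$m_\ell^+=q_{1-\epsilon^+}^{\mathrm{joint}+}\,a_\ell^+,\qquad m_\ell^-=q_{1-\epsilon^-}^{\mathrm{joint}-}\,a_\ell^-,\qquad \ell\in\mathcal E,$$ and let $\mathcal M_\ell(\bm r^{\mathrm{new}})=\left\{-m_\ell^-\le[K(\bm r^{\mathrm{new}}-\widehat{\bm\mu}_r)]_\ell\le m_\ell^+\right\}$. Then $$\mathbb P\left(\bigcap_{\ell\in\mathcal E}\mathcal M_\ell(\bm r^{\mathrm{new}})\,\middle|\,\mathcal D_{\mathrm{tr}}\right)\ge 1-\epsilon.$$
   Context: Network: $\mathcal G=(\mathcal N,\mathcal E)$ is a connected graph with $n$ buses (nodes) and finitely many transmission lines (edges), each arbitrarily oriented. $A\in\mathbb R^{|\mathcal E|\times n}$ is the line-bus incidence matrix, $B=\operatorname{diag}(b_\ell)$ is the diagonal matrix of line susceptances, $L=A^\top BA$ is the weighted Laplacian (with $\operatorname{null}(L)=\operatorname{span}\{\bm 1\}$), $L^\dagger$ is its Moore--Penrose pseudo-inverse, $f_\ell^{\max}>0$ are thermal limits, $D=\operatorname{diag}(1/f_\ell^{\max})$, and $K=DBAL^\dagger\in\mathbb R^{|\mathcal E|\times n}$ is the injection-to-line-loading map. Residuals: all residuals are of the form $\bm r=(I-\bm\alpha\bm 1^\top)\bm\omega$ for a random forecast error $\bm\omega\in\mathbb R^n$ and a fixed $\bm\alpha\in\mathbb R^n_+$ with $\bm 1^\top\bm\alpha=1$. Denote the training residuals by $\bm r^{\mathrm{tr},(1)},\dots,\bm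 r^{\mathrm{tr},(N_{\mathrm{tr}})}$; in the paper $\widehat{\bm\mu}_r=\frac1{N_{\mathrm{tr}}}\sum_{j}\bm r^{\mathrm{tr},(j)}$. One-sided scales: with a fixed $\eta>0$ and $y_\ell^{\mathrm{tr},(j)}=[K(\bm r^{\mathrm{tr},(j)}-\widehat{\bm\mu}_r)]_\ell$, $$a_\ell^{\pm}=\left(\eta^2+\frac1{N_{\mathrm{tr}}-1}\sum_{j=1}^{N_{\mathrm{tr}}}\left[\pm y_\ell^{\mathrm{tr},(j)}\right]_+^2\right)^{1/2}.$$ The probability is over the joint draw of the calibration residuals (on which the margins depend) and $\bm r^{\mathrm{new}}$, conditionally on $\mathcal D_{\mathrm{tr}}$. *)

theory Defs
  imports "HOL-Probability.Probability" "HOL-Combinatorics.Permutations"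
    "Graph_Theory.Digraph_Component"
begin

section \<open>Moore--Penrose pseudo-inverse\<close>

definition is_pseudo_inverse :: "real^'n^'m \<Rightarrow> real^'m^'n \<Rightarrow> bool" where
  "is_pseudo_inverse A X \<longleftrightarrow>
     A ** X ** A = A \<and> X ** A ** X = X \<and>
     transpose (A ** X) = A ** X \<and> transpose (X ** A) = X ** A"

definition pseudo_inverse :: "real^'n^'m \<Rightarrow> real^'m^'n" where
  "pseudo_inverse A = (THE X. is_pseudo_inverse A X)"

lemma is_pseudo_inverse_unique:
  assumes X: "is_pseudo_inverse A X" and Y: "is_pseudo_inverse A Y"
  shows "X = Y"
proof -
  have AX: "A ** X = A ** Y"
  proof -
    have "A ** X = transpose (A ** Y ** (A ** X))"
      using X Y by (metis is_pseudo_inverse_def matrix_mul_assoc)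
    also have "\<dots> = transpose (A ** X) ** transpose (A ** Y)"
      by (simp add: matrix_transpose_mul)
    also have "\<dots> = A ** X ** (A ** Y)"
      using X Y by (simp add: is_pseudo_inverse_def)
    also have "\<dots> = A ** Y"
      using X by (metis is_pseudo_inverse_def matrix_mul_assoc)
    finally show ?thesis .
  qed
  have XA: "X ** A = Y ** A"
  proof -
    have "X ** A = transpose (X ** A ** (Y ** A))"
      using X Y by (metis is_pseudo_inverse_def matrix_mul_assoc)
    also have "\<dots> = transpose (Y ** A) ** transpose (X ** A)"
      by (simp add: matrix_transpose_mul)
    also have "\<dots> = Y ** A ** (X ** A)"
      using X Y by (simp add: is_pseudo_inverse_def)
    also have "\<dots> = Y ** A"
      using X by (metis is_pseudo_inverse_def matrix_mul_assoc)
    finally show ?thesis .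
  qed
  show ?thesis
    using X Y AX XA by (metis is_pseudo_inverse_def matrix_mul_assoc)
qed

lemma orthogonal_projection_exists:
  fixes S :: "(real^'n) set"
  assumes "subspace S"
  obtains P :: "real^'n^'n" where "transpose P = P" "\<And>x. P *v x \<in> S"
    "\<And>x. x \<in> S \<Longrightarrow> P *v x = x"
proof -
  obtain B where B: "B \<subseteq> S" "pairwise orthogonal B" "\<And>x. x \<in> B \<Longrightarrow> norm x = 1"
      "independent B" "span B = S"
    using orthonormal_basis_subspace[OF assms] by metis
  have fin: "finite B"
    using B(4) independent_imp_finite by blast
  define p where "p x = (\<Sum>b\<in>B. (x \<bullet> b) *\<^sub>R b)" for x :: "real^'n"
  have lin: "linear p"
    by (rule linearI)
      (simp_all add: p_def inner_add_left scaleR_add_left sum.distrib scaleR_sum_right)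
  have pB: "p b = b" if "b \<in> B" for b
  proof -
    have "p b = (\<Sum>c\<in>B. if c = b then b else 0)"
      unfolding p_def using B(2,3) that
      by (intro sum.cong refl)
        (auto simp: pairwise_def orthogonal_def inner_commute norm_eq_1)
    then show ?thesis using fin that by simp
  qed
  have id: "p x = x" if "x \<in> S" for x
    using linear_eq_on[OF lin linear_id, of x B] pB that B(5) by simp
  have mem: "p x \<in> S" for x
    unfolding p_def using assms B(1) by (intro subspace_sum subspace_scale) auto
  have sym: "p x \<bullet> y = x \<bullet> p y" for x y
    by (simp add: p_def inner_sum_left inner_sum_right inner_commute mult.commute)
  have mat: "matrix p *v x = p x" for x
    using lin by (simp add: matrix_works)
  have "transpose (matrix p) *v x = matrix p *v x" for x
  proof -
    have "y \<bullet> (transpose (matrix p) *v x) = y \<bullet> (matrix p *v x)" for y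
      using sym[of y x] mat by (metis dot_lmul_matrix inner_commute vector_transpose_matrix transpose_matrix_vector)
    then show ?thesis using vector_eq_ldot by blast
  qed
  then have "transpose (matrix p) = matrix p" by (simp add: matrix_eq)
  with that[of "matrix p"] id mem mat show thesis by simp
qed

lemma is_pseudo_inverse_exists:
  fixes A :: "real^'n^'m"
  shows "\<exists>X. is_pseudo_inverse A X"
proof -
  define R where "R = range (\<lambda>x. A *v x)"
  define S where "S = range (\<lambda>y. transpose A *v y)"
  have subR: "subspace R" and subS: "subspace S"
    unfolding R_def S_def
    by (rule linear_subspace_image[OF matrix_vector_mul_linear subspace_UNIV])+
  obtain P where P: "transpose P = P" "\<And>y. P *v y \<in> R" "\<And>y. y \<in> R \<Longrightarrow> P *v y = y"
    using orthogonal_projection_exists[OF subR] by blast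
  obtain Q where Q: "transpose Q = Q" "\<And>x. Q *v x \<in> S" "\<And>x. x \<in> S \<Longrightarrow> Q *v x = x"
    using orthogonal_projection_exists[OF subS] by blast
  have PA: "P ** A = A"
    by (auto simp: matrix_eq matrix_vector_mul_assoc[symmetric] R_def intro!: P(3))
  have "Q ** transpose A = transpose A"
    by (auto simp: matrix_eq matrix_vector_mul_assoc[symmetric] S_def intro!: Q(3))
  then have AQ: "A ** Q = A"
    by (metis Q(1) matrix_transpose_mul transpose_transpose)
  have inj: "inj_on (\<lambda>x. A *v x) S"
  proof (rule inj_onI)
    fix x x' assume xx: "x \<in> S" "x' \<in> S" "A *v x = A *v x'"
    then obtain y where y: "x - x' = transpose A *v y"
      using subspace_diff[OF subS] unfolding S_def by blast
    have "(x - x') \<bullet> (x - x') = y \<bullet> (A *v (x - x'))"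
      by (subst y) (simp add: y dot_lmul_matrix)
    also have "\<dots> = 0"
      using xx(3) by (simp add: matrix_vector_mult_diff_distrib)
    finally show "x = x'" by simp
  qed
  obtain g where g: "range g \<subseteq> S" "linear g" "\<And>x. x \<in> S \<Longrightarrow> g (A *v x) = x"
    using linear_exists_left_inverse_on[OF matrix_vector_mul_linear subS inj] by blast
  define X where "X = matrix g ** P"
  have X: "X *v y = g (P *v y)" for y
    using g(2) by (simp add: X_def matrix_vector_mul_assoc[symmetric] matrix_works)
  have gA: "g (A *v x) = Q *v x" for x
    using g(3)[OF Q(2)] by (metis AQ matrix_vector_mul_assoc)
  have XA: "X ** A = Q"
    by (simp add: matrix_eq matrix_vector_mul_assoc[symmetric] X gA)
      (metis PA gA matrix_vector_mul_assoc)
  have AX: "A ** X = P"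
  proof -
    have "A *v g (P *v y) = P *v y" for y
    proof -
      obtain x where "P *v y = A *v x" using P(2)[of y] unfolding R_def by blast
      then show ?thesis using gA AQ by (metis matrix_vector_mul_assoc)
    qed
    then show ?thesis by (simp add: matrix_eq matrix_vector_mul_assoc[symmetric] X)
  qed
  have "Q ** X = X"
    using g(1) Q(3) by (auto simp: matrix_eq matrix_vector_mul_assoc[symmetric] X)
  then have "is_pseudo_inverse A X"
    by (simp add: is_pseudo_inverse_def XA AX PA P(1) Q(1))
  then show ?thesis by blast
qed

lemma is_pseudo_inverse_pseudo_inverse: "is_pseudo_inverse A (pseudo_inverse A)"
  unfolding pseudo_inverse_def
  using is_pseudo_inverse_exists is_pseudo_inverse_unique by (metis theI)


section \<open>Network matrices\<close>

definition diag_matrix :: "('e::finite \<Rightarrow> real) \<Rightarrow> real^'e^'e" where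
  "diag_matrix d = (\<chi> i j. if i = j then d i else 0)"

definition incidence_matrix :: "('n::finite, 'e::finite) pre_digraph \<Rightarrow> real^'n^'e" where
  "incidence_matrix G =
     (\<chi> l i. if i = tail G l then 1 else if i = head G l then - 1 else 0)"

definition laplacian :: "('n::finite, 'e::finite) pre_digraph \<Rightarrow> ('e \<Rightarrow> real) \<Rightarrow> real^'n^'n" where
  "laplacian G b =
     transpose (incidence_matrix G) ** diag_matrix b ** incidence_matrix G"

definition loading_matrix ::
    "('n::finite, 'e::finite) pre_digraph \<Rightarrow> ('e \<Rightarrow> real) \<Rightarrow> ('e \<Rightarrow> real) \<Rightarrow> real^'n^'e" where
  "loading_matrix G b fmax =
     diag_matrix (\<lambda>l. 1 / fmax l) ** diag_matrix b ** incidence_matrix G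
       ** pseudo_inverse (laplacian G b)"

definition residual :: "real^'n \<Rightarrow> real^'n \<Rightarrow> real^'n" where
  "residual \<alpha> \<omega> = (mat 1 - (\<chi> i j. \<alpha> $ i * (1 :: real^'n) $ j)) *v \<omega>"


section \<open>One-sided scales, joint scores and split-conformal quantiles\<close>

definition one_sided_scale :: "real \<Rightarrow> nat \<Rightarrow> (nat \<Rightarrow> real) \<Rightarrow> real" where
  "one_sided_scale \<eta> N y =
     sqrt (\<eta>\<^sup>2 + 1 / (real N - 1) * (\<Sum>j = 1..N. (max (y j) 0)\<^sup>2))"

definition joint_score :: "('e::finite \<Rightarrow> real) \<Rightarrow> ('e \<Rightarrow> real) \<Rightarrow> real" where
  "joint_score a y = Max (range (\<lambda>l. max (y l) 0 / a l))"

text \<open>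
  The entries \<open>R 1, \<dots>, R N\<close> are sorted with multiplicity. For \<open>0 < \<epsilon> < 1\<close> the rank
  \<open>k\<close> lies between \<open>1\<close> and \<open>N + 1\<close>, so the second branch is exactly the case \<open>k = N + 1\<close>.
\<close>
definition conformal_quantile :: "real \<Rightarrow> nat \<Rightarrow> (nat \<Rightarrow> real) \<Rightarrow> ereal" where
  "conformal_quantile \<epsilon> N R =
     (let k = nat \<lceil>(real N + 1) * (1 - \<epsilon>)\<rceil>
      in if k \<le> N then ereal (sort (map R [1..<N + 1]) ! (k - 1)) else \<infinity>)"


section \<open>Conditional probability and conditional exchangeability\<close>

definition generated_sigma_algebra ::
    "'a measure \<Rightarrow> 'i set \<Rightarrow> ('i \<Rightarrow> 'a \<Rightarrow> 'b::topological_space) \<Rightarrow> 'a measure" where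
  "generated_sigma_algebra M I X =
     vimage_algebra (space M) (\<lambda>x. \<lambda>i\<in>I. X i x) (Pi\<^sub>M I (\<lambda>_. borel))"

lemma sample_mean_measurable:
  fixes X :: "nat \<Rightarrow> 'a \<Rightarrow> real^'n"
  shows "(\<lambda>x. (1 / real N) *\<^sub>R (\<Sum>j = 1..N. X j x))
    \<in> borel_measurable (generated_sigma_algebra M {1..N} X)"
proof -
  let ?V = "\<lambda>x. \<lambda>i\<in>{1..N}. X i x"
  have V: "?V \<in> measurable (generated_sigma_algebra M {1..N} X) (Pi\<^sub>M {1..N} (\<lambda>_. borel))"
    unfolding generated_sigma_algebra_def
    by (rule measurable_vimage_algebra1) (auto simp: space_PiM)
  have "(\<lambda>v. (1 / real N) *\<^sub>R (\<Sum>j = 1..N. v j))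
      \<in> borel_measurable (Pi\<^sub>M {1..N} (\<lambda>_. borel :: (real^'n) measure))"
    by (intro borel_measurable_scaleR borel_measurable_const borel_measurable_sum
        measurable_component_singleton)
  from measurable_compose[OF V this] show ?thesis by simp
qed

text \<open>A version of the conditional probability; it is determined up to null sets.\<close>
definition conditional_prob :: "'a measure \<Rightarrow> 'a measure \<Rightarrow> 'a set \<Rightarrow> 'a \<Rightarrow> real" where
  "conditional_prob M F E = real_cond_exp M F (indicator E)"

definition conditionally_exchangeable ::
    "'a measure \<Rightarrow> 'a measure \<Rightarrow> 'i set \<Rightarrow> ('i \<Rightarrow> 'a \<Rightarrow> 'b::topological_space) \<Rightarrow> bool" where
  "conditionally_exchangeable M F I X \<longleftrightarrow>
     (\<forall>\<pi> S. \<pi> permutes I \<longrightarrow> S \<in> sets (Pi\<^sub>M I (\<lambda>_. borel)) \<longrightarrow>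
       (AE x in M.
          conditional_prob M F {x \<in> space M. (\<lambda>i\<in>I. X (\<pi> i) x) \<in> S} x =
          conditional_prob M F {x \<in> space M. (\<lambda>i\<in>I. X i x) \<in> S} x))"

end

theory Submission
  imports Defs
begin

text \<open>
  A score of the new residual is at most the split-conformal quantile exactly when its rank among all
  \<open>N + 1\<close> scores is below \<open>k\<close>. Always at least \<open>k\<close> of the \<open>N + 1\<close> indices have such a rank, and by
  conditional exchangeability each of them has the same chance, also when intersected with an event
  \<open>A\<close> of the training \<open>\<sigma>\<close>-algebra; hence the new one has it with probability at least
  \<open>k / (N + 1) * P A \<ge> (1 - \<epsilon>) * P A\<close>. The margin event is the intersection of the upper and the lower
  score event, so a union bound on every such \<open>A\<close> gives the conditional statement.
\<close>

section \<open>Ranks, order statistics and the conformal quantile\<close>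

text \<open>Among the indices of rank at least \<open>k\<close>, pick one with the smallest value:
  everything strictly below it has rank less than \<open>k\<close>, and there are at least
  \<open>k\<close> such indices. Tied indices share the same rank, so ties do no harm.\<close>

lemma card_rank_less_ge:
  fixes V :: "'i \<Rightarrow> 'v::linorder"
  assumes "finite I" "k \<le> card I"
  shows "k \<le> card {i \<in> I. card {j \<in> I. V j < V i} < k}"
proof (cases "{i \<in> I. \<not> card {j \<in> I. V j < V i} < k} = {}")
  case True
  then have "{i \<in> I. card {j \<in> I. V j < V i} < k} = I" by blast
  then show ?thesis using assms by simp
next
  case False
  define B where "B = {i \<in> I. \<not> card {j \<in> I. V j < V i} < k}"
  have "finite B" "B \<noteq> {}" using False assms(1) by (auto simp: B_def)
  then obtain i where i: "i \<in> B" "\<And>j. j \<in> B \<Longrightarrow> V i \<le> V j"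
    using ex_min_if_finite[of "V ` B"] by (metis arg_min_if_finite not_le)
  have "{j \<in> I. V j < V i} \<subseteq> {i \<in> I. card {j \<in> I. V j < V i} < k}"
    using i(2) by (fastforce simp: B_def)
  then have "card {j \<in> I. V j < V i} \<le> card {i \<in> I. card {j \<in> I. V j < V i} < k}"
    using assms(1) by (intro card_mono) auto
  moreover have "k \<le> card {j \<in> I. V j < V i}" using i(1) by (simp add: B_def)
  ultimately show ?thesis by linarith
qed

text \<open>Sorting preserves the number of entries below \<open>v\<close> and moves them into an
  initial segment; position \<open>k\<close> lies outside that segment exactly when its length is at
  most \<open>k\<close>.\<close>

lemma le_sort_nth_iff:
  fixes xs :: "'v::linorder list"
  assumes "k < length xs"
  shows "v \<le> sort xs ! k \<longleftrightarrow> length (filter (\<lambda>x. x < v) xs) \<le> k"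
proof -
  let ?s = "sort xs"
  have len: "length (filter (\<lambda>x. x < v) xs) = card {j. j < length ?s \<and> ?s ! j < v}"
  proof -
    have "length (filter (\<lambda>x. x < v) xs) = length (filter (\<lambda>x. x < v) ?s)"
      by (simp flip: size_mset)
    then show ?thesis by (simp only: length_filter_conv_card)
  qed
  show ?thesis
  proof
    assume v: "v \<le> ?s ! k"
    have "{j. j < length ?s \<and> ?s ! j < v} \<subseteq> {..<k}"
    proof safe
      fix j assume "j < length ?s" "?s ! j < v"
      then show "j < k"
        using v sorted_nth_mono[of ?s k j] by fastforce
    qed
    then have "card {j. j < length ?s \<and> ?s ! j < v} \<le> card {..<k}"
      by (intro card_mono) auto
    then show "length (filter (\<lambda>x. x < v) xs) \<le> k" by (simp add: len)
  next
    assume le: "length (filter (\<lambda>x. x < v) xs) \<le> k"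
    show "v \<le> ?s ! k"
    proof (rule ccontr)
      assume "\<not> v \<le> ?s ! k"
      then have "{..k} \<subseteq> {j. j < length ?s \<and> ?s ! j < v}"
        using assms sorted_nth_mono[of ?s _ k] by fastforce
      then have "card {..k} \<le> card {j. j < length ?s \<and> ?s ! j < v}"
        by (intro card_mono) auto
      then show False using le len by simp
    qed
  qed
qed

text \<open>Replaces the quantile by a count, which treats both branches alike: for
  \<open>k > N\<close> the quantile is infinite, and a count of at most \<open>N\<close> is below
  \<open>k\<close> anyway.\<close>

lemma le_conformal_quantile_iff:
  assumes "0 < \<epsilon>" "\<epsilon> < 1"
  shows "ereal v \<le> conformal_quantile \<epsilon> N R \<longleftrightarrow>
    card {j \<in> {1..N}. R j < v} < nat \<lceil>(real N + 1) * (1 - \<epsilon>)\<rceil>"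
proof -
  define k where "k = nat \<lceil>(real N + 1) * (1 - \<epsilon>)\<rceil>"
  have "0 < (real N + 1) * (1 - \<epsilon>)" using assms by simp
  \<comment> \<open>This makes the truncated difference \<open>k - 1\<close> genuine, so that "at
    most \<open>k - 1\<close>" means "less than \<open>k\<close>".\<close>
  then have k: "1 \<le> k" unfolding k_def by linarith
  have cnt: "length (filter (\<lambda>x. x < v) (map R [1..<N + 1])) = card {j \<in> {1..N}. R j < v}"
  proof -
    have "length (filter (\<lambda>x. x < v) (map R [1..<N + 1]))
        = length (filter (\<lambda>j. R j < v) [1..<N + 1])"
      by (simp add: filter_map o_def del: upt_Suc)
    also have "\<dots> = card (set (filter (\<lambda>j. R j < v) [1..<N + 1]))"
      by (rule distinct_card[symmetric]) simp
    also have "set (filter (\<lambda>j. R j < v) [1..<N + 1]) = {j \<in> {1..N}. R j < v}"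
      by auto
    finally show ?thesis .
  qed
  show ?thesis
  proof (cases "k \<le> N")
    case True
    then have "k - 1 < length (map R [1..<N + 1])" using k by simp
    from le_sort_nth_iff[OF this, of v] show ?thesis
      using True k cnt by (simp add: conformal_quantile_def k_def[symmetric] del: upt_Suc) linarith
  next
    case False
    have "card {j \<in> {1..N}. R j < v} \<le> card {1..N}"
      by (intro card_mono) auto
    then show ?thesis
      using False by (simp add: conformal_quantile_def k_def[symmetric])
  qed
qed

section \<open>Conditional probability tested on events of the sub-algebra\<close>

lemma (in finite_measure_subalgebra) set_lebesgue_integral_conditional_prob:
  assumes "A \<in> sets F" "E \<in> sets M"
  shows "(LINT x:A|M. conditional_prob M F E x) = measure M (A \<inter> E)"
proof -
  have A: "A \<in> sets M" using assms(1) subalg by (auto simp: subalgebra_def)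
  have "integrable M (indicator E :: 'a \<Rightarrow> real)"
    using assms(2) by (simp add: less_top[symmetric])
  from real_cond_exp_intA[OF this assms(1)]
  have "(LINT x:A|M. conditional_prob M F E x) = (LINT x:A|M. indicator E x)"
    by (simp add: conditional_prob_def)
  also have "\<dots> = (\<integral>x. indicator (A \<inter> E) x \<partial>M)"
    by (simp add: set_lebesgue_integral_def indicator_inter_arith)
  also have "\<dots> = measure M (A \<inter> E)"
    using A assms(2) sets.sets_into_space by (fastforce intro: arg_cong[where f = "measure M"])
  finally show ?thesis .
qed

text \<open>The set \<open>A\<close> where the conditional probability \<open>p\<close> falls below
  \<open>c\<close> belongs to \<open>F\<close>, so the hypothesis applies to it. It makes the
  integral of \<open>c - p\<close> over \<open>A\<close> at most 0, although the integrand is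
  positive there; hence \<open>A\<close> is null.\<close>

lemma (in finite_measure_subalgebra) conditional_prob_geI:
  assumes E: "E \<in> sets M"
    and ge: "\<And>A. A \<in> sets F \<Longrightarrow> c * measure M A \<le> measure M (A \<inter> E)"
  shows "AE x in M. c \<le> conditional_prob M F E x"
proof -
  define p where "p = conditional_prob M F E"
  have pF: "p \<in> borel_measurable F" and pM [measurable]: "p \<in> borel_measurable M"
    by (auto simp: p_def conditional_prob_def)
  have int: "integrable M p"
    unfolding p_def conditional_prob_def
    using E by (intro real_cond_exp_int) (simp add: less_top[symmetric])
  have sp: "space F = space M" using subalg by (simp add: subalgebra_def)
  define A where "A = {x \<in> space M. p x < c}"
  have A: "A \<in> sets F"
    using pF unfolding A_def sp[symmetric] by measurable
  then have AM: "A \<in> sets M" using subalg by (auto simp: subalgebra_def)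
  let ?h = "\<lambda>x. indicator A x * (c - p x)"
  have int1: "integrable M (\<lambda>x. indicator A x * c)"
    and int2: "integrable M (\<lambda>x. indicator A x * p x)"
    using AM int integrable_mult_indicator[OF AM, of p] integrable_mult_indicator[OF AM, of "\<lambda>_. c"]
    by auto
  have h: "?h = (\<lambda>x. indicator A x * c - indicator A x * p x)"
    by (auto simp: algebra_simps)
  have inth: "integrable M ?h" unfolding h using int1 int2 by simp
  have nonneg: "AE x in M. 0 \<le> ?h x" by (auto simp: A_def indicator_def)
  have "(\<integral>x. ?h x \<partial>M) = c * measure M A - (LINT x:A|M. p x)"
    unfolding h using int1 int2 AM sets.sets_into_space[OF AM]
    by (simp add: set_lebesgue_integral_def Int_absorb2 mult.commute)
  also have "\<dots> = c * measure M A - measure M (A \<inter> E)"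
    unfolding p_def using set_lebesgue_integral_conditional_prob[OF A E] by simp
  also have "\<dots> \<le> 0" using ge[OF A] by simp
  finally have "(\<integral>x. ?h x \<partial>M) = 0"
    using integral_nonneg_AE[OF nonneg] by simp
  then have "AE x in M. ?h x = 0"
    using integral_nonneg_eq_0_iff_AE[OF inth nonneg] by simp
  then show ?thesis
    by (rule AE_mp) (auto intro!: AE_I2 simp: A_def indicator_def p_def split: if_splits)
qed

text \<open>The first coordinate keeps the outcome, seen through \<open>F\<close>, so that events on
  the product may involve \<open>F\<close>-measurable parameters as well as the family. The identity
  from \<open>M\<close> to \<open>F\<close> is measurable because \<open>F\<close> is
  coarser.\<close>

lemma measurable_graph_PiM:
  assumes "subalgebra M F" "X \<in> I \<rightarrow> borel_measurable M"
  shows "(\<lambda>x. (x, \<lambda>i\<in>I. X i x)) \<in> measurable M (F \<Otimes>\<^sub>M Pi\<^sub>M I (\<lambda>_. borel))"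
  using assms(2) measurable_from_subalg[OF assms(1) measurable_ident_sets[OF refl]]
  by (intro measurable_Pair measurable_restrict) auto

text \<open>
  Conditioning on \<open>F\<close> leaves every \<open>F\<close>-measurable quantity fixed, so exchangeability extends from
  \<open>X\<close> to the pair of \<open>X\<close> with the identity map into \<open>F\<close>: both sides agree on rectangles.
\<close>
lemma conditionally_exchangeable_measure_eq:
  fixes X :: "'i \<Rightarrow> 'a \<Rightarrow> 'b::topological_space"
  assumes M: "prob_space M" and F: "subalgebra M F"
    and exch: "conditionally_exchangeable M F I X"
    and X: "X \<in> I \<rightarrow> borel_measurable M"
    and \<pi>: "\<pi> permutes I"
    and T: "T \<in> sets (F \<Otimes>\<^sub>M Pi\<^sub>M I (\<lambda>_. borel))"
  shows "measure M {x \<in> space M. (x, \<lambda>i\<in>I. X (\<pi> i) x) \<in> T} =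
    measure M {x \<in> space M. (x, \<lambda>i\<in>I. X i x) \<in> T}"
proof -
  interpret prob_space M by fact
  interpret finite_measure_subalgebra M F by unfold_locales fact
  let ?P = "Pi\<^sub>M I (\<lambda>_. borel :: 'b measure)"
  let ?E = "{A \<times> S | A S. A \<in> sets F \<and> S \<in> sets ?P}"
  let ?Z = "\<lambda>x. (x, \<lambda>i\<in>I. X i x)" and ?Z' = "\<lambda>x. (x, \<lambda>i\<in>I. X (\<pi> i) x)"
  have sp: "space F = space M" using F by (simp add: subalgebra_def)
  have Z: "?Z \<in> measurable M (F \<Otimes>\<^sub>M ?P)"
    using X by (rule measurable_graph_PiM[OF F])
  have Z': "?Z' \<in> measurable M (F \<Otimes>\<^sub>M ?P)"
    using X \<pi> by (intro measurable_graph_PiM[OF F]) (auto simp: permutes_in_image)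
  have "distr M (F \<Otimes>\<^sub>M ?P) ?Z' = distr M (F \<Otimes>\<^sub>M ?P) ?Z"
  \<comment> \<open>Rectangles are an intersection-stable generator. The whole space is itself a
    rectangle of finite mass, so a constant sequence serves as the exhaustion.\<close>
  proof (rule measure_eqI_generator_eq[OF Int_stable_pair_measure_generator[of F ?P],
        where A = "\<lambda>_. space F \<times> space ?P" and \<Omega> = "space F \<times> space ?P"])
    show "?E \<subseteq> Pow (space F \<times> space ?P)"
      by (auto dest: sets.sets_into_space[THEN subsetD])
    fix C assume "C \<in> ?E"
    then obtain A S where C: "C = A \<times> S" and A: "A \<in> sets F" and S: "S \<in> sets ?P"
      by blast
    have AM: "A \<subseteq> space M" using sets.sets_into_space[OF A] sp by simp
    let ?G = "\<lambda>Y. {x \<in> space M. (\<lambda>i\<in>I. Y i x) \<in> S}"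
    have meas: "?G Y \<in> sets M" if "\<And>i. i \<in> I \<Longrightarrow> Y i \<in> borel_measurable M" for Y :: "'i \<Rightarrow> 'a \<Rightarrow> 'b"
    proof -
      have "(\<lambda>x. \<lambda>i\<in>I. Y i x) -` S \<inter> space M \<in> sets M"
        using that by (intro measurable_sets[OF measurable_restrict S])
      also have "(\<lambda>x. \<lambda>i\<in>I. Y i x) -` S \<inter> space M = ?G Y" by auto
      finally show ?thesis .
    qed
    have G: "?G X \<in> sets M" "?G (\<lambda>i. X (\<pi> i)) \<in> sets M"
      using X \<pi> by (auto intro!: meas simp: permutes_in_image)
    \<comment> \<open>Exchangeability speaks about the side \<open>S\<close> only; integrating it
      over \<open>A\<close> adds the other side of the rectangle.\<close>
    have "AE x in M. conditional_prob M F (?G (\<lambda>i. X (\<pi> i))) x = conditional_prob M F (?G X) x"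
      using exch \<pi> S unfolding conditionally_exchangeable_def by blast
    then have "(LINT x:A|M. conditional_prob M F (?G (\<lambda>i. X (\<pi> i))) x) =
        (LINT x:A|M. conditional_prob M F (?G X) x)"
      unfolding set_lebesgue_integral_def
      using A F by (intro integral_cong_AE)
        (auto simp: conditional_prob_def subalgebra_def intro!: borel_measurable_scaleR)
    then have "measure M (A \<inter> ?G (\<lambda>i. X (\<pi> i))) = measure M (A \<inter> ?G X)"
      using G A by (simp add: set_lebesgue_integral_conditional_prob)
    moreover have "?Z' -` C \<inter> space M = A \<inter> ?G (\<lambda>i. X (\<pi> i))"
      "?Z -` C \<inter> space M = A \<inter> ?G X"
      using AM by (auto simp: C)
    moreover have "C \<in> sets (F \<Otimes>\<^sub>M ?P)" using A S C by simp
    ultimately show "emeasure (distr M (F \<Otimes>\<^sub>M ?P) ?Z') C = emeasure (distr M (F \<Otimes>\<^sub>M ?P) ?Z) C"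
      by (simp only: emeasure_distr[OF Z] emeasure_distr[OF Z'] emeasure_eq_measure)
  next
    show "range (\<lambda>_. space F \<times> space ?P) \<subseteq> ?E" by blast
    interpret Z': finite_measure "distr M (F \<Otimes>\<^sub>M ?P) ?Z'"
      using Z' by (rule finite_measure_distr)
    show "emeasure (distr M (F \<Otimes>\<^sub>M ?P) ?Z') (space F \<times> space ?P) \<noteq> \<infinity>"
      using Z'.emeasure_finite by simp
  qed (simp_all add: sets_pair_measure)
  then have "measure M (?Z' -` T \<inter> space M) = measure M (?Z -` T \<inter> space M)"
    using measure_distr[OF Z T] measure_distr[OF Z' T] by simp
  moreover have "?Z' -` T \<inter> space M = {x \<in> space M. ?Z' x \<in> T}"
    "?Z -` T \<inter> space M = {x \<in> space M. ?Z x \<in> T}"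
    by auto
  ultimately show ?thesis by simp
qed

section \<open>Split-conformal coverage on every conditioning event\<close>

text \<open>The score takes the outcome as an argument so that it may use training quantities;
  measurability over \<open>F\<close> in that argument confines it to what is conditioned on.
  Coverage is stated on each \<open>A\<close> of \<open>F\<close>, the form in which a union bound
  can be applied.\<close>

lemma conditional_split_conformal_coverage:
  fixes X :: "nat \<Rightarrow> 'a \<Rightarrow> 'b::topological_space" and s :: "'a \<Rightarrow> 'b \<Rightarrow> real"
  assumes M: "prob_space M" and F: "subalgebra M F"
    and exch: "conditionally_exchangeable M F {1..N + 1} X"
    and X: "X \<in> {1..N + 1} \<rightarrow> borel_measurable M"
    and s: "(\<lambda>(x, r). s x r) \<in> borel_measurable (F \<Otimes>\<^sub>M borel)"
    and \<epsilon>: "0 < \<epsilon>" "\<epsilon> < 1"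
  defines "C \<equiv> {x \<in> space M.
      ereal (s x (X (N + 1) x)) \<le> conformal_quantile \<epsilon> N (\<lambda>i. s x (X i x))}"
  shows "C \<in> sets M"
    and "A \<in> sets F \<Longrightarrow> (1 - \<epsilon>) * measure M A \<le> measure M (A \<inter> C)"
proof -
  interpret prob_space M by fact
  define I where "I = {1..N + 1}"
  define k where "k = nat \<lceil>(real N + 1) * (1 - \<epsilon>)\<rceil>"
  have fin: "finite I" and last: "N + 1 \<in> I" by (auto simp: I_def)
  have "(real N + 1) * (1 - \<epsilon>) \<le> real N + 1"
    using \<epsilon> by (intro mult_left_le) auto
  then have "\<lceil>(real N + 1) * (1 - \<epsilon>)\<rceil> \<le> int (N + 1)"
    by (simp only: ceiling_le_iff of_int_of_nat_eq of_nat_add of_nat_1)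
  moreover have "card I = N + 1" by (simp add: I_def)
  ultimately have k: "k \<le> card I" by (simp only: k_def nat_le_iff)
  let ?P = "F \<Otimes>\<^sub>M Pi\<^sub>M I (\<lambda>_. borel :: 'b measure)"
  have sp: "space F = space M" using F by (simp add: subalgebra_def)
  have Z: "(\<lambda>x. (x, \<lambda>i\<in>I. X i x)) \<in> measurable M ?P"
    using X by (intro measurable_graph_PiM[OF F]) (simp add: I_def)
  have s_meas [measurable]: "(\<lambda>p. s (fst p) (snd p i)) \<in> borel_measurable ?P" if "i \<in> I" for i
  proof -
    have "(\<lambda>p. (fst p, snd p i)) \<in> measurable ?P (F \<Otimes>\<^sub>M borel)"
      using that by measurable
    from measurable_compose[OF this s] show ?thesis by simp
  qed
  \<comment> \<open>The event that index \<open>i\<close> has rank below \<open>k\<close>, expressed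
    on the product space so that it can be transported along permutations.\<close>
  define T where "T i = {p \<in> space ?P.
      card {j \<in> I. s (fst p) (snd p j) < s (fst p) (snd p i)} < k}" for i
  have T: "T i \<in> sets ?P" if i: "i \<in> I" for i
  proof -
    have less: "{p \<in> space ?P. j \<in> {j \<in> I. s (fst p) (snd p j) < s (fst p) (snd p i)}} \<in> sets ?P" for j
      using s_meas[OF i] s_meas[of j] by (cases "j \<in> I") auto
    have "(\<lambda>p. card {j \<in> I. s (fst p) (snd p j) < s (fst p) (snd p i)})
        \<in> measurable ?P (count_space UNIV)"
      by (rule measurable_card) (rule less)
    then have "(\<lambda>p. card {j \<in> I. s (fst p) (snd p j) < s (fst p) (snd p i)}) -` {..<k} \<inter> space ?P
        \<in> sets ?P"
      by (rule measurable_sets) simp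
    also have "(\<lambda>p. card {j \<in> I. s (fst p) (snd p j) < s (fst p) (snd p i)}) -` {..<k} \<inter> space ?P = T i"
      by (auto simp: T_def)
    finally show ?thesis .
  qed
  define rk where "rk i x = card {j \<in> I. s x (X j x) < s x (X i x)}" for i x
  define E where "E i = {x \<in> space M. rk i x < k}" for i
  have E_T: "E i = {x \<in> space M. (x, \<lambda>j\<in>I. X j x) \<in> T i}" if "i \<in> I" for i
    using that by (auto simp: E_def T_def rk_def space_pair_measure space_PiM sp cong: conj_cong)
  have E: "E i \<in> sets M" if "i \<in> I" for i
  proof -
    have "(\<lambda>x. (x, \<lambda>i\<in>I. X i x)) -` T i \<inter> space M = E i"
      using E_T[OF that] by auto
    then show ?thesis using measurable_sets[OF Z T[OF that]] by simp
  qed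
  \<comment> \<open>The new score is not strictly below itself, so counting over all
    \<open>N + 1\<close> indices or over the \<open>N\<close> calibration indices gives the same
    number.\<close>
  have C_E: "C = E (N + 1)"
  proof -
    have "{j \<in> {1..N}. s x (X j x) < s x (X (N + 1) x)} = {j \<in> I. s x (X j x) < s x (X (N + 1) x)}" for x
      by (auto simp: I_def le_Suc_eq)
    then show ?thesis
      using le_conformal_quantile_iff[OF \<epsilon>, of _ N] by (simp add: C_def E_def rk_def k_def)
  qed
  then show "C \<in> sets M" using E last by simp
  assume A: "A \<in> sets F"
  then have AM: "A \<in> sets M" using F by (auto simp: subalgebra_def)
  have sym: "measure M (A \<inter> E i) = measure M (A \<inter> C)" if i: "i \<in> I" for i
  proof -
    \<comment> \<open>After this swap the last place is held by \<open>X i\<close>, so the rank of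
      the last index becomes that of \<open>i\<close>.\<close>
    define \<pi> where "\<pi> = Transposition.transpose i (N + 1)"
    have \<pi>: "\<pi> permutes I" unfolding \<pi>_def using i last by (rule permutes_swap_id)
    \<comment> \<open>The cylinder over \<open>A\<close> expresses membership of the outcome in
      \<open>A\<close>; the permutation leaves that coordinate fixed.\<close>
    have Tm: "T (N + 1) \<inter> (A \<times> space (Pi\<^sub>M I (\<lambda>_. borel))) \<in> sets ?P" (is "?T \<in> _")
      using T[OF last] A by simp
    have "{x \<in> space M. (x, \<lambda>j\<in>I. X (\<pi> j) x) \<in> ?T} = A \<inter> E i"
    proof -
      have "card {j \<in> I. s x (X (\<pi> j) x) < s x (X i x)} = rk i x" for x
        unfolding rk_def
        by (intro bij_betw_same_card[of \<pi>] bij_betwI[where g = \<pi>])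
          (auto simp: permutes_in_image[OF \<pi>], simp_all add: \<pi>_def)
      moreover have "\<pi> (N + 1) = i" by (simp add: \<pi>_def)
      ultimately show ?thesis
        using last sets.sets_into_space[OF A] sp
        by (auto simp: T_def E_def space_pair_measure space_PiM cong: conj_cong)
    qed
    moreover have "{x \<in> space M. (x, \<lambda>j\<in>I. X j x) \<in> ?T} = A \<inter> C"
      unfolding C_E E_T[OF last] using sets.sets_into_space[OF A] sp
      by (auto simp: space_PiM)
    ultimately show ?thesis
      using conditionally_exchangeable_measure_eq[OF M F exch[folded I_def] X[folded I_def] \<pi> Tm]
      by simp
  qed
  \<comment> \<open>Double counting: each outcome in \<open>A\<close> lies in at least
    \<open>k\<close> of the events \<open>E i\<close>, and all of these have the same measure within
    \<open>A\<close>.\<close>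
  have "real k * measure M A = (\<integral>x. real k * indicator A x \<partial>M)"
    using AM sets.sets_into_space[OF AM] by (simp add: Int_absorb2)
  also have "\<dots> \<le> (\<integral>x. (\<Sum>i\<in>I. indicator (A \<inter> E i) x) \<partial>M)"
  proof (rule integral_mono)
    fix x assume x: "x \<in> space M"
    have "real k \<le> real (card {i \<in> I. rk i x < k})"
      using card_rank_less_ge[OF fin k, of "\<lambda>i. s x (X i x)"] by (simp add: rk_def)
    also have "\<dots> = (\<Sum>i\<in>{i \<in> I. rk i x < k}. 1)" by simp
    also have "\<dots> = (\<Sum>i\<in>I. if rk i x < k then 1 else 0)" using fin by (rule sum.inter_filter)
    also have "\<dots> = (\<Sum>i\<in>I. indicator (E i) x)" using x by (simp add: E_def indicator_def of_bool_def)
    finally show "real k * indicator A x \<le> (\<Sum>i\<in>I. indicator (A \<inter> E i) x)"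
      by (auto simp: indicator_def)
  qed (use AM E in \<open>auto simp: less_top[symmetric]\<close>)
  also have "\<dots> = (\<Sum>i\<in>I. measure M (A \<inter> E i))"
    using AM E by (subst Bochner_Integration.integral_sum)
      (auto simp: less_top[symmetric] E_def intro!: sum.cong arg_cong[where f = "measure M"])
  also have "\<dots> = (real N + 1) * measure M (A \<inter> C)"
    by (simp add: sym) (simp add: I_def)
  finally have "real k * measure M A \<le> (real N + 1) * measure M (A \<inter> C)" .
  moreover have "(real N + 1) * (1 - \<epsilon>) \<le> real k"
    unfolding k_def by (rule real_nat_ceiling_ge)
  then have "(real N + 1) * (1 - \<epsilon>) * measure M A \<le> real k * measure M A"
    by (rule mult_right_mono) simp
  ultimately have "(real N + 1) * ((1 - \<epsilon>) * measure M A) \<le> (real N + 1) * measure M (A \<inter> C)"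
    unfolding mult.assoc by (rule order_trans[rotated])
  then show "(1 - \<epsilon>) * measure M A \<le> measure M (A \<inter> C)"
    by (subst (asm) mult_le_cancel_left_pos) auto
qed

section \<open>Positivity, and from scores back to margins\<close>

lemma one_sided_scale_pos:
  assumes "N \<ge> 2" "\<eta> > 0"
  shows "one_sided_scale \<eta> N y > 0"
  using assms unfolding one_sided_scale_def
  by (intro real_sqrt_gt_zero add_pos_nonneg mult_nonneg_nonneg sum_nonneg) auto

lemma joint_score_nonneg:
  assumes "\<And>l. a l > 0"
  shows "0 \<le> joint_score a y"
proof -
  \<comment> \<open>\<open>undefined\<close> stands for an arbitrary line; any single term bounds
    the maximum from below.\<close>
  have "0 \<le> max (y undefined) 0 / a undefined" using assms[of undefined] by simp
  also have "\<dots> \<le> joint_score a y" unfolding joint_score_def by (rule Max_ge) auto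
  finally show ?thesis .
qed

text \<open>No score lies below 0, so the count at \<open>v = 0\<close> is zero, hence below the
  positive rank \<open>k\<close>.\<close>

lemma conformal_quantile_nonneg:
  assumes "0 < \<epsilon>" "\<epsilon> < 1" "\<And>i. 0 \<le> R i"
  shows "0 \<le> conformal_quantile \<epsilon> N R"
proof -
  have "0 < (real N + 1) * (1 - \<epsilon>)" using assms by simp
  moreover have none: "{j \<in> {1..N}. R j < 0} = {}" using assms(3) by (auto simp: not_less)
  ultimately show ?thesis
    using le_conformal_quantile_iff[OF assms(1,2), of 0 N R] unfolding none
    by (simp add: zero_ereal_def)
qed

text \<open>For a nonnegative bound \<open>q\<close> the clipping at 0 costs nothing, and the
  maximum makes one score inequality equivalent to the margins on all lines at once. No union bound
  over lines is therefore incurred. An infinite \<open>q\<close> stays infinite after multiplication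
  by a positive scale.\<close>

lemma joint_score_le_iff:
  assumes a: "\<And>l. a l > 0" and q: "0 \<le> q"
  shows "ereal (joint_score a y) \<le> q \<longleftrightarrow> (\<forall>l. ereal (y l) \<le> q * ereal (a l))"
proof (cases q)
  case (real u)
  have "max (y l) 0 / a l \<le> u \<longleftrightarrow> y l \<le> u * a l" for l
    using a[of l] q real by (auto simp: divide_le_eq)
  then show ?thesis using real by (simp add: joint_score_def)
next
  case PInf
  moreover have "\<infinity> * ereal (a l) = \<infinity>" for l using a[of l] by simp
  ultimately show ?thesis by simp
next
  case MInf
  then show ?thesis using q by simp
qed

section \<open>Measurability of the training quantities and scores\<close>

lemma borel_measurable_matrix_vector_mult [measurable (raw)]:
  fixes K :: "real^'n^'m"
  assumes "f \<in> borel_measurable M"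
  shows "(\<lambda>x. K *v f x) \<in> borel_measurable M"
  by (rule borel_measurable_continuous_on[OF _ assms])
    (intro linear_continuous_on matrix_vector_mul_bounded_linear)

lemma borel_measurable_vec_nth_compose [measurable (raw)]:
  fixes f :: "'a \<Rightarrow> real^'m"
  assumes "f \<in> borel_measurable M"
  shows "(\<lambda>x. f x $ l) \<in> borel_measurable M"
  by (rule borel_measurable_continuous_on[OF _ assms])
    (intro linear_continuous_on bounded_linear_vec_nth)

lemma subalgebra_generated_sigma_algebra:
  assumes "\<And>i. i \<in> I \<Longrightarrow> X i \<in> borel_measurable M"
  shows "subalgebra M (generated_sigma_algebra M I X)"
  using measurable_sets[OF measurable_restrict[of I X M "\<lambda>_. borel"]] assms
  by (auto simp: subalgebra_def generated_sigma_algebra_def sets_vimage_algebra2 space_PiM)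

lemma measurable_generated_sigma_algebra:
  assumes "i \<in> I"
  shows "X i \<in> borel_measurable (generated_sigma_algebra M I X)"
proof -
  have "(\<lambda>x. \<lambda>i\<in>I. X i x) \<in> measurable (generated_sigma_algebra M I X) (Pi\<^sub>M I (\<lambda>_. borel))"
    unfolding generated_sigma_algebra_def
    by (rule measurable_vimage_algebra1) (auto simp: space_PiM)
  from measurable_compose[OF this measurable_component_singleton[OF assms]] assms
  show ?thesis by simp
qed

lemma borel_measurable_one_sided_scale [measurable (raw)]:
  assumes "\<And>j. j \<in> {1..N} \<Longrightarrow> y j \<in> borel_measurable M"
  shows "(\<lambda>x. one_sided_scale \<eta> N (\<lambda>j. y j x)) \<in> borel_measurable M"
  unfolding one_sided_scale_def using assms by measurable

lemma borel_measurable_joint_score [measurable (raw)]: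
  assumes "\<And>l. a l \<in> borel_measurable M" "\<And>l. y l \<in> borel_measurable M"
  shows "(\<lambda>x. joint_score (\<lambda>l. a l x) (\<lambda>l. y l x)) \<in> borel_measurable M"
  unfolding joint_score_def using assms by measurable

section \<open>Joint coverage of the two-sided margins\<close>

theorem proposition3:
  fixes M :: "'a measure"
    and G :: "('n::finite, 'e::finite) pre_digraph"
    and b fmax :: "'e \<Rightarrow> real"
    and K :: "real^'n^'e"
    and \<alpha> :: "real^'n"
    and N_tr N_cal :: nat
    and \<omega>_tr \<omega>_cal r_tr r_cal :: "nat \<Rightarrow> 'a \<Rightarrow> real^'n"
    and \<omega>_new r_new :: "'a \<Rightarrow> real^'n"
    and D_tr :: "'a measure"
    and \<mu> :: "'a \<Rightarrow> real^'n"
    and \<eta> \<epsilon> \<epsilon>_plus \<epsilon>_minus :: real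
    and y_tr y_cal :: "nat \<Rightarrow> 'e \<Rightarrow> 'a \<Rightarrow> real"
    and a_plus a_minus :: "'e \<Rightarrow> 'a \<Rightarrow> real"
    and R_plus R_minus :: "nat \<Rightarrow> 'a \<Rightarrow> real"
    and q_plus q_minus :: "'a \<Rightarrow> ereal"
    and m_plus m_minus :: "'e \<Rightarrow> 'a \<Rightarrow> ereal"
    and margin_event :: "'e \<Rightarrow> 'a set"
  assumes "prob_space M"
    \<comment> \<open>network\<close>
    and "loopfree_digraph G" and "verts G = UNIV" and "arcs G = UNIV"
    and "Digraph_Component.connected G"
    and "{v. laplacian G b *v v = 0} = span {1}"
    and "\<And>l. fmax l > 0"
    and "K = loading_matrix G b fmax"
    \<comment> \<open>residuals\<close>
    and "\<And>i. \<alpha> $ i \<ge> 0" and "(\<Sum>i\<in>UNIV. \<alpha> $ i) = 1"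
    and "\<And>j. j \<in> {1..N_tr} \<Longrightarrow> \<omega>_tr j \<in> borel_measurable M"
    and "\<And>i. i \<in> {1..N_cal} \<Longrightarrow> \<omega>_cal i \<in> borel_measurable M"
    and "\<omega>_new \<in> borel_measurable M"
    and "\<And>j x. r_tr j x = residual \<alpha> (\<omega>_tr j x)"
    and "\<And>i x. r_cal i x = residual \<alpha> (\<omega>_cal i x)"
    and "\<And>x. r_new x = residual \<alpha> (\<omega>_new x)"
    \<comment> \<open>training\<close>
    and "N_tr \<ge> 2"
    and "D_tr = generated_sigma_algebra M {1..N_tr} r_tr"
    and "\<mu> \<in> borel_measurable D_tr"
    and "\<eta> > 0"
    and "\<And>j l x. y_tr j l x = (K *v (r_tr j x - \<mu> x)) $ l"
    and "\<And>l x. a_plus l x = one_sided_scale \<eta> N_tr (\<lambda>j. y_tr j l x)"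
    and "\<And>l x. a_minus l x = one_sided_scale \<eta> N_tr (\<lambda>j. - y_tr j l x)"
    \<comment> \<open>calibration\<close>
    and "conditionally_exchangeable M D_tr {1..N_cal + 1} (r_cal(N_cal + 1 := r_new))"
    and "\<And>i l x. y_cal i l x = (K *v (r_cal i x - \<mu> x)) $ l"
    and "\<And>i x. R_plus i x = joint_score (\<lambda>l. a_plus l x) (\<lambda>l. y_cal i l x)"
    and "\<And>i x. R_minus i x = joint_score (\<lambda>l. a_minus l x) (\<lambda>l. - y_cal i l x)"
    and "0 < \<epsilon>_plus" and "\<epsilon>_plus < 1" and "0 < \<epsilon>_minus" and "\<epsilon>_minus < 1"
    and "\<epsilon> = \<epsilon>_plus + \<epsilon>_minus"
    and "\<And>x. q_plus x = conformal_quantile \<epsilon>_plus N_cal (\<lambda>i. R_plus i x)"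
    and "\<And>x. q_minus x = conformal_quantile \<epsilon>_minus N_cal (\<lambda>i. R_minus i x)"
    and "\<And>l x. m_plus l x = q_plus x * ereal (a_plus l x)"
    and "\<And>l x. m_minus l x = q_minus x * ereal (a_minus l x)"
    and "\<And>l. margin_event l =
           {x \<in> space M. - m_minus l x \<le> ereal ((K *v (r_new x - \<mu> x)) $ l) \<and>
                         ereal ((K *v (r_new x - \<mu> x)) $ l) \<le> m_plus l x}"
  shows "AE x in M. conditional_prob M D_tr (\<Inter>l\<in>arcs G. margin_event l) x \<ge> 1 - \<epsilon>"
proof -
  interpret prob_space M by fact
  define X where "X = r_cal(N_cal + 1 := r_new)"
  have res: "residual \<alpha> \<in> borel_measurable borel"
    unfolding residual_def[abs_def] by measurable
  have r_meas: "r \<in> borel_measurable M"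
    if "\<omega> \<in> borel_measurable M" "\<And>x. r x = residual \<alpha> (\<omega> x)" for r \<omega> :: "'a \<Rightarrow> real^'n"
    using measurable_compose[OF that(1) res] that(2) by (simp cong: measurable_cong)
  have X: "X \<in> {1..N_cal + 1} \<rightarrow> borel_measurable M"
  proof
    fix i assume i: "i \<in> {1..N_cal + 1}"
    show "X i \<in> borel_measurable M"
    proof (cases "i = N_cal + 1")
      case True
      then show ?thesis using r_meas[OF assms(13,16)] by (simp add: X_def)
    next
      case False
      then have "i \<in> {1..N_cal}" using i by auto
      from r_meas[OF assms(12)[OF this] assms(15)] show ?thesis
        using False by (simp add: X_def)
    qed
  qed
  have D: "subalgebra M D_tr"
    unfolding \<open>D_tr = _\<close>
    by (rule subalgebra_generated_sigma_algebra) (rule r_meas[OF assms(11) assms(14)])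
  interpret finite_measure_subalgebra M D_tr by unfold_locales (fact D)
  have \<mu> [measurable]: "\<mu> \<in> borel_measurable D_tr" by fact
  have r_tr [measurable]: "r_tr j \<in> borel_measurable D_tr" if "j \<in> {1..N_tr}" for j
    unfolding \<open>D_tr = _\<close> using that by (rule measurable_generated_sigma_algebra)
  have a_pos: "a_plus l x > 0" "a_minus l x > 0" for l x
    using one_sided_scale_pos[OF \<open>N_tr \<ge> 2\<close> \<open>\<eta> > 0\<close>] assms(22,23) by simp_all
  have a_meas [measurable]: "a_plus l \<in> borel_measurable D_tr" "a_minus l \<in> borel_measurable D_tr" for l
  proof -
    have "(\<lambda>x. one_sided_scale \<eta> N_tr (\<lambda>j. (K *v (r_tr j x - \<mu> x)) $ l)) \<in> borel_measurable D_tr"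
      "(\<lambda>x. one_sided_scale \<eta> N_tr (\<lambda>j. - ((K *v (r_tr j x - \<mu> x)) $ l))) \<in> borel_measurable D_tr"
      by (rule borel_measurable_one_sided_scale; measurable)+
    moreover have "a_plus l = (\<lambda>x. one_sided_scale \<eta> N_tr (\<lambda>j. (K *v (r_tr j x - \<mu> x)) $ l))"
      "a_minus l = (\<lambda>x. one_sided_scale \<eta> N_tr (\<lambda>j. - ((K *v (r_tr j x - \<mu> x)) $ l)))"
      by (auto simp: assms(21-23))
    ultimately show "a_plus l \<in> borel_measurable D_tr" "a_minus l \<in> borel_measurable D_tr"
      by simp_all
  qed
  \<comment> \<open>Scores as functions of the outcome and a candidate residual; the outcome enters
    only through \<mu> and the scales, all measurable with respect to \<open>D_tr\<close>.\<close>
  define s_plus where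
    "s_plus x r = joint_score (\<lambda>l. a_plus l x) (\<lambda>l. (K *v (r - \<mu> x)) $ l)" for x r
  define s_minus where
    "s_minus x r = joint_score (\<lambda>l. a_minus l x) (\<lambda>l. - ((K *v (r - \<mu> x)) $ l))" for x r
  have s_meas: "(\<lambda>(x, r). s_plus x r) \<in> borel_measurable (D_tr \<Otimes>\<^sub>M borel)"
    "(\<lambda>(x, r). s_minus x r) \<in> borel_measurable (D_tr \<Otimes>\<^sub>M borel)"
    unfolding s_plus_def s_minus_def split_beta' by measurable
  \<comment> \<open>The quantile reads only indices up to \<open>N_cal\<close>, where
    \<open>X\<close> agrees with \<open>r_cal\<close>; the new residual at \<open>N_cal + 1\<close>
    does not enter.\<close>
  have q: "q_plus x = conformal_quantile \<epsilon>_plus N_cal (\<lambda>i. s_plus x (X i x))"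
    "q_minus x = conformal_quantile \<epsilon>_minus N_cal (\<lambda>i. s_minus x (X i x))" for x
    unfolding assms(33,34) conformal_quantile_def
    by (auto simp: s_plus_def s_minus_def X_def assms(25-27) simp del: upt_Suc
        intro!: arg_cong[where f = "\<lambda>xs. sort xs ! _"] map_cong)
  have q_nonneg: "0 \<le> q_plus x" "0 \<le> q_minus x" for x
    unfolding q using a_pos assms(28-31)
    by (auto intro!: conformal_quantile_nonneg joint_score_nonneg simp: s_plus_def s_minus_def)
  define C_plus where "C_plus = {x \<in> space M. ereal (s_plus x (X (N_cal + 1) x)) \<le> q_plus x}"
  define C_minus where "C_minus = {x \<in> space M. ereal (s_minus x (X (N_cal + 1) x)) \<le> q_minus x}"
  note exch = assms(24)[folded X_def]
  note cov_plus = conditional_split_conformal_coverage[OF \<open>prob_space M\<close> D exch X s_meas(1)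
      \<open>0 < \<epsilon>_plus\<close> \<open>\<epsilon>_plus < 1\<close>, folded q, folded C_plus_def]
  note cov_minus = conditional_split_conformal_coverage[OF \<open>prob_space M\<close> D exch X s_meas(2)
      \<open>0 < \<epsilon>_minus\<close> \<open>\<epsilon>_minus < 1\<close>, folded q, folded C_minus_def]
  \<comment> \<open>Turns the lower margin into an upper bound on the negated loading, which is what
    the minus score controls.\<close>
  have "- m \<le> ereal y \<longleftrightarrow> ereal (- y) \<le> m" for m y
    using ereal_uminus_le_reorder[of m "ereal y"] by simp
  then have event: "(\<Inter>l\<in>arcs G. margin_event l) = C_plus \<inter> C_minus"
    unfolding C_plus_def C_minus_def s_plus_def s_minus_def joint_score_le_iff[OF a_pos(1) q_nonneg(1)]
      joint_score_le_iff[OF a_pos(2) q_nonneg(2)]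
    by (auto simp: \<open>arcs G = UNIV\<close> assms(35-37) X_def)
  show ?thesis
    unfolding event
  proof (rule conditional_prob_geI)
    show "C_plus \<inter> C_minus \<in> sets M" using cov_plus(1) cov_minus(1) by blast
    fix A assume A: "A \<in> sets D_tr"
    then have AM: "A \<in> sets M" using D by (auto simp: subalgebra_def)
    \<comment> \<open>Inclusion-exclusion inside \<open>A\<close>. As the union has measure at most
      that of \<open>A\<close>, the two coverage bounds combine to the factor
      \<open>(1 - \<epsilon>_plus) + (1 - \<epsilon>_minus) - 1\<close>, which is
      \<open>1 - \<epsilon>\<close>.\<close>
    have "measure M (A \<inter> C_plus) + measure M (A \<inter> C_minus)
        = measure M (A \<inter> C_plus \<union> A \<inter> C_minus) + measure M (A \<inter> (C_plus \<inter> C_minus))"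
      using finite_measure_Union'[of "A \<inter> C_plus" "A \<inter> C_minus"]
        finite_measure_Diff'[of "A \<inter> C_minus" "A \<inter> C_plus"] AM cov_plus(1) cov_minus(1)
      by (simp add: Int_ac)
    moreover have "measure M (A \<inter> C_plus \<union> A \<inter> C_minus) \<le> measure M A"
      using AM by (intro finite_measure_mono) auto
    ultimately show "(1 - \<epsilon>) * measure M A \<le> measure M (A \<inter> (C_plus \<inter> C_minus))"
      using cov_plus(2)[OF A] cov_minus(2)[OF A] \<open>\<epsilon> = _\<close> by (simp add: algebra_simps)
  qed
qed

end
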